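(* Let $G=(V,E)$ be a semilinear graph of constant complexity on $n$ vertices. Then $G$ has a biclique cover of size $O(n\,\mathrm{polylog}\, n)$. That is, for every fixed $t\in\mathbb{N}$ there exist constants $C,c>0$, depending only on $t$, such that every semilinear graph of complexity $t$ on $n\ge 2$ vertices has a biclique cover of size at most $C\,n\,(\log n)^{c}$.
   Context: All graphs are finite and simple. A biclique is a complete bipartite graph. A biclique cover of a graph $G$ is a collection $\mathcal{H}$ of (not necessarily induced) subgraphs of $G$, each of which is a biclique, such that every edge of $G$ belongs to at least one member of $\mathcal{H}$. The size of $\mathcal{H}$ is $\sum_{H\in\mathcal{H}}|V(H)|$. A graph $G=(V,E)$ is a semilinear graph of complexity $t$ if for some $d$ there exist: a map $\varphi:V\to\mathbb{R}^d$; $t$ linear functions (polynomials of degree at most one) $f_1,\ldots,f_t\in\mathbb{R}[x_1,\ldots,x_d,y_1,\ldots,y_d]$ in $2d$ variables; and a boolean function $\Phi:\{\mathrm{T},\mathrm{F}\}^{3t}\to\{\mathrm{T},\mathrm{F}\}$, such that for any two distinct $u,v\in V$, $$uv\in E \iff \Phi\left(\{f_i(\varphi(u),\varphi(v))<0,\ f_i(\varphi(u),\varphi(v))=0,\ f_i(\varphi(u),\varphi(v))\le 0\}_{i\in[t]}\right)=\mathrm{T}.$$ *)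

theory Defs
  imports Complex_Main "Graph_Theory.Graph_Theory"
begin

text \<open>
  A finite simple graph is a \<^term>\<open>G :: 'a pair_pre_digraph\<close> with \<^prop>\<open>pair_graph G\<close>: the vertex
  set is \<^term>\<open>pverts G\<close>, and an edge \<open>uv\<close> is represented by the two arcs \<open>(u, v)\<close> and \<open>(v, u)\<close>
  in \<^term>\<open>parcs G\<close>.
\<close>

definition biclique :: "'a pair_pre_digraph \<Rightarrow> bool" where
  "biclique H \<longleftrightarrow> (\<exists>m n. 1 \<le> m \<and> 1 \<le> n \<and> complete_bipartite_digraph m n (with_proj H))"

definition biclique_cover :: "'a pair_pre_digraph \<Rightarrow> 'a pair_pre_digraph set \<Rightarrow> bool" where
  "biclique_cover G \<H> \<longleftrightarrow>
     finite \<H> \<and>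
     (\<forall>H\<in>\<H>. subgraph (with_proj H) (with_proj G) \<and> biclique H) \<and>
     (\<forall>e\<in>parcs G. \<exists>H\<in>\<H>. e \<in> parcs H)"

definition cover_size :: "'a pair_pre_digraph set \<Rightarrow> nat" where
  "cover_size \<H> = (\<Sum>H\<in>\<H>. card (pverts H))"

text \<open>
  Since the dimension \<open>d\<close> is quantified inside the definition of semilinearity, a point of
  \<open>d\<close>-dimensional space is a function \<^typ>\<open>nat \<Rightarrow> real\<close> of which only the coordinates below
  \<open>d\<close> matter. The following are the polynomials of degree at most one in the \<open>2d\<close> variables
  \<open>x 0, \<dots>, x (d - 1), y 0, \<dots>, y (d - 1)\<close>.
\<close>

definition linear_poly2 :: "nat \<Rightarrow> ((nat \<Rightarrow> real) \<Rightarrow> (nat \<Rightarrow> real) \<Rightarrow> real) \<Rightarrow> bool" where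
  "linear_poly2 d f \<longleftrightarrow>
     (\<exists>a b c. \<forall>x y. f x y = (\<Sum>j<d. a j * x j) + (\<Sum>j<d. b j * y j) + c)"

text \<open>
  The boolean function \<open>\<Phi>\<close> is only ever applied to lists of length \<open>3 * t\<close>.
\<close>

definition semilinear_graph :: "nat \<Rightarrow> 'a pair_pre_digraph \<Rightarrow> bool" where
  "semilinear_graph t G \<longleftrightarrow>
     pair_graph G \<and>
     (\<exists>(d :: nat) (\<phi> :: 'a \<Rightarrow> nat \<Rightarrow> real)
        (f :: nat \<Rightarrow> (nat \<Rightarrow> real) \<Rightarrow> (nat \<Rightarrow> real) \<Rightarrow> real)
        (\<Phi> :: bool list \<Rightarrow> bool).
        (\<forall>i<t. linear_poly2 d (f i)) \<and>
        (\<forall>u\<in>pverts G. \<forall>v\<in>pverts G. u \<noteq> v \<longrightarrow>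
           ((u, v) \<in> parcs G \<longleftrightarrow>
            \<Phi> (concat (map (\<lambda>i. [f i (\<phi> u) (\<phi> v) < 0,
                                  f i (\<phi> u) (\<phi> v) = 0,
                                  f i (\<phi> u) (\<phi> v) \<le> 0]) [0..<t])))))"

end

theory Submission
  imports Defs
begin

text \<open>
  Each sign condition \<open>f\<^sub>i(\<phi> u, \<phi> v) < 0\<close> or \<open>f\<^sub>i(\<phi> u, \<phi> v) \<le> 0\<close> separates into a comparison of a
  number depending on \<open>u\<close> with a number depending on \<open>v\<close>, and so does its negation. Fixing the truth
  values of these \<open>2t\<close> conditions, and orienting every edge by an injective numbering of the vertices,
  it is enough to cover the pairs that satisfy \<open>k = 2t + 1\<close> simultaneous comparisons. For one of them,
  order the left and right points jointly and cut the order in the middle: pairs inside a half are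
  handled by recursion on the size, pairs from the first to the second half all satisfy the
  comparison and need only the remaining \<open>k - 1\<close>, and pairs from the second to the first half all
  violate it. Every comparison thus costs one logarithmic factor.
\<close>

section \<open>Threshold relations and their halving\<close>

text \<open>Every \<open>v\<close> selects an initial segment of the left points with respect to one
  common order by \<open>p\<close>. No cut value is attached to \<open>v\<close>, so strict and
  non-strict comparisons and their negations fit the same notion.\<close>

definition threshold :: "('a \<Rightarrow> 'b \<Rightarrow> bool) \<Rightarrow> bool" where
  "threshold R \<longleftrightarrow> (\<exists>p :: 'a \<Rightarrow> real. \<forall>u u' v. p u \<le> p u' \<longrightarrow> R u' v \<longrightarrow> R u v)"

text \<open>Negating a comparison reverses the order on the left points, hence the sign change for a
  false \<open>b\<close>.\<close>

lemma threshold_less: "threshold (\<lambda>u v. \<alpha> u + \<beta> v < (0::real) \<longleftrightarrow> b)"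
  unfolding threshold_def
  by (rule exI[of _ "if b then \<alpha> else - \<alpha>"]) auto

lemma threshold_le: "threshold (\<lambda>u v. \<alpha> u + \<beta> v \<le> (0::real) \<longleftrightarrow> b)"
  unfolding threshold_def
  by (rule exI[of _ "if b then \<alpha> else - \<alpha>"]) auto

text \<open>The joint order of left and right points is never constructed; its initial segment grows
  one point at a time. If the \<open>p\<close>-least remaining left point is related to all
  remaining right points, it comes next. Otherwise some remaining \<open>v\<close> is unrelated to
  it, hence to every remaining left point, and \<open>v\<close> comes next.\<close>

lemma threshold_split:
  assumes "finite A" "finite B" "threshold R" "s \<le> card A + card B"
  shows "\<exists>A1 B1. A1 \<subseteq> A \<and> B1 \<subseteq> B \<and> card A1 + card B1 = s \<and>
           (\<forall>u\<in>A1. \<forall>v\<in>B - B1. R u v) \<and> (\<forall>u\<in>A - A1. \<forall>v\<in>B1. \<not> R u v)"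
  using assms(4)
proof (induction s)
  case 0
  show ?case by (intro exI[of _ "{}"]) auto
next
  case (Suc s)
  then obtain A1 B1 where sub: "A1 \<subseteq> A" "B1 \<subseteq> B" and card: "card A1 + card B1 = s"
    and yes: "\<forall>u\<in>A1. \<forall>v\<in>B - B1. R u v" and no: "\<forall>u\<in>A - A1. \<forall>v\<in>B1. \<not> R u v"
    by auto
  have fin: "finite A1" "finite B1" "finite (A - A1)"
    using sub assms(1,2) finite_subset by auto
  obtain p :: "'a \<Rightarrow> real" where p: "\<And>u u' v. p u \<le> p u' \<Longrightarrow> R u' v \<Longrightarrow> R u v"
    using assms(3) unfolding threshold_def by blast
  have add_right: ?case if b: "b \<in> B - B1" and "\<forall>u\<in>A - A1. \<not> R u b" for b
  proof -
    have "card (insert b B1) = Suc (card B1)" using b fin by simp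
    then show ?thesis
      using sub card yes no that by (intro exI[of _ A1] exI[of _ "insert b B1"]) auto
  qed
  show ?case
  proof (cases "A - A1 = {}")
    case True
    then have "A1 = A" using sub by blast
    then have "B1 \<noteq> B" using Suc.prems card by auto
    then show ?thesis using add_right sub True by blast
  next
    case False
    let ?a = "arg_min_on p (A - A1)"
    have a: "?a \<in> A - A1" and min: "p ?a \<le> p u" if "u \<in> A - A1" for u
      using that arg_min_if_finite(1)[OF fin(3) False] arg_min_least[OF fin(3) False] by auto
    show ?thesis
    proof (cases "\<forall>v\<in>B - B1. R ?a v")
      case True
      have "?a \<in> A - A1" using a False by blast
      moreover have "card (insert ?a A1) = Suc (card A1)" using calculation fin by simp
      ultimately show ?thesis
        using sub card yes no True by (intro exI[of _ "insert ?a A1"] exI[of _ B1]) auto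
    next
      case False
      then show ?thesis using add_right min p by blast
    qed
  qed
qed

section \<open>Covering relations by combinatorial rectangles\<close>

text \<open>Equality with \<open>S\<close> keeps non-edges out. Rectangles may overlap, and a side
  may be empty.\<close>

definition rect_cover :: "('a set \<times> 'b set) set \<Rightarrow> ('a \<times> 'b) set \<Rightarrow> bool" where
  "rect_cover P S \<longleftrightarrow> finite P \<and> (\<Union>(A, B)\<in>P. A \<times> B) = S"

definition rect_size :: "('a set \<times> 'b set) set \<Rightarrow> nat" where
  "rect_size P = (\<Sum>(A, B)\<in>P. card A + card B)"

lemma rect_cover_empty: "rect_cover {} {}"
  by (simp add: rect_cover_def)

lemma rect_cover_Un: "rect_cover P S \<Longrightarrow> rect_cover Q T \<Longrightarrow> rect_cover (P \<union> Q) (S \<union> T)"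
  by (auto simp: rect_cover_def)

lemma rect_size_Un:
  assumes "rect_cover P S" "rect_cover Q T"
  shows "rect_size (P \<union> Q) \<le> rect_size P + rect_size Q"
  using assms sum.union_inter[of P Q "\<lambda>(A, B). card A + card B"]
  unfolding rect_cover_def rect_size_def by linarith

lemma rect_cover_UN:
  assumes "finite I" "\<And>i. i \<in> I \<Longrightarrow> \<exists>P. rect_cover P (S i) \<and> rect_size P \<le> c"
  shows "\<exists>P. rect_cover P (\<Union>i\<in>I. S i) \<and> rect_size P \<le> card I * c"
  using assms
proof (induction I)
  case empty
  show ?case using rect_cover_empty by (auto simp: rect_size_def)
next
  case (insert i I)
  then obtain P where P: "rect_cover P (\<Union>i\<in>I. S i)" "rect_size P \<le> card I * c"
    by auto
  obtain Q where Q: "rect_cover Q (S i)" "rect_size Q \<le> c" using insert.prems by blast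
  show ?case
    using rect_cover_Un[OF Q(1) P(1)] rect_size_Un[OF Q(1) P(1)] P(2) Q(2) insert.hyps
    by (intro exI[of _ "Q \<union> P"]) auto
qed

text \<open>Divide and conquer: the outer induction removes a relation, the inner one halves the
  point set. The bound closes because
  \<open>(m + 1) * (m + 2) ^ k + (m + 2) ^ k = (m + 2) ^ (k + 1)\<close>.\<close>

lemma rect_cover_thresholds:
  fixes A :: "'a set" and B :: "'b set"
  assumes "finite A" "finite B" "card A + card B \<le> 2 ^ m" "\<forall>R\<in>set Rs. threshold R"
  shows "\<exists>P. rect_cover P {(u, v) \<in> A \<times> B. \<forall>R\<in>set Rs. R u v} \<and>
             rect_size P \<le> (card A + card B) * (m + 1) ^ length Rs"
  using assms
proof (induction Rs arbitrary: A B m)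
  case Nil
  show ?case by (intro exI[of _ "{(A, B)}"]) (auto simp: rect_cover_def rect_size_def)
next
  case (Cons R Rs)
  note remaining = Cons.IH
  have thr: "threshold R" "\<forall>R\<in>set Rs. threshold R" using Cons.prems by auto
  let ?S = "\<lambda>A B. {(u, v) \<in> A \<times> B. \<forall>R\<in>set (R # Rs). R u v}"
  show ?case using Cons.prems(1-3)
  proof (induction m arbitrary: A B)
    case 0
    \<comment> \<open>With at most one point in total, one side is empty.\<close>
    then have "A \<times> B = {}" by (cases "card A") auto
    then have "?S A B = {}" by blast
    then show ?case using rect_cover_empty by (intro exI[of _ "{}"]) (simp only: rect_size_def, simp)
  next
    case (Suc m)
    \<comment> \<open>The minimum handles fewer than \<open>2 ^ m\<close> points, where the second
      part is empty. In either case both parts have at most \<open>2 ^ m\<close> points.\<close>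
    let ?s = "min (card A + card B) (2 ^ m)"
    obtain A1 B1 where sub: "A1 \<subseteq> A" "B1 \<subseteq> B" and card1: "card A1 + card B1 = ?s"
      and yes: "\<forall>u\<in>A1. \<forall>v\<in>B - B1. R u v" and no: "\<forall>u\<in>A - A1. \<forall>v\<in>B1. \<not> R u v"
      using threshold_split[OF Suc.prems(1,2) thr(1), of ?s] by auto
    define A2 B2 where "A2 = A - A1" and "B2 = B - B1"
    have fin: "finite A1" "finite B1" "finite A2" "finite B2"
      using sub Suc.prems finite_subset unfolding A2_def B2_def by auto
    have cA: "card A = card A1 + card A2" and cB: "card B = card B1 + card B2"
      unfolding A2_def B2_def
      using sub Suc.prems fin by (simp_all add: card_Diff_subset card_mono)
    have card2: "card A2 + card B2 \<le> 2 ^ m" using card1 cA cB Suc.prems(3) by auto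
    let ?M = "(m + 1) ^ length (R # Rs)" and ?L = "(m + 2) ^ length Rs"
    obtain P1 where P1: "rect_cover P1 (?S A1 B1)" "rect_size P1 \<le> (card A1 + card B1) * ?M"
      using Suc.IH[OF fin(1,2)] card1 by auto
    obtain P2 where P2: "rect_cover P2 (?S A2 B2)" "rect_size P2 \<le> (card A2 + card B2) * ?M"
      using Suc.IH[OF fin(3,4)] card2 by auto
    \<comment> \<open>\<open>R\<close> holds throughout \<open>A1 \<times> B2\<close>, so only
      \<open>Rs\<close> remains. These sides come from different parts and may exceed
      \<open>2 ^ m\<close> points together, so the exponent stays at \<open>Suc m\<close>.\<close>
    obtain P3 where P3: "rect_cover P3 {(u, v) \<in> A1 \<times> B2. \<forall>R\<in>set Rs. R u v}"
        "rect_size P3 \<le> (card A1 + card B2) * ?L"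
      using remaining[OF fin(1,4) _ thr(2), of "Suc m"] cA cB Suc.prems(3) by auto
    let ?P = "P1 \<union> P2 \<union> P3"
    \<comment> \<open>The block \<open>A2 \<times> B1\<close> contributes nothing, since
      \<open>R\<close> fails on it.\<close>
    have "?S A B = ?S A1 B1 \<union> ?S A2 B2 \<union> {(u, v) \<in> A1 \<times> B2. \<forall>R\<in>set Rs. R u v}"
      using sub yes no unfolding A2_def B2_def by auto
    then have cover: "rect_cover ?P (?S A B)"
      using rect_cover_Un[OF rect_cover_Un[OF P1(1) P2(1)] P3(1)] by simp
    have "rect_size ?P \<le> rect_size P1 + rect_size P2 + rect_size P3"
      using rect_size_Un[OF rect_cover_Un[OF P1(1) P2(1)] P3(1)] rect_size_Un[OF P1(1) P2(1)]
      by linarith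
    also have "\<dots> \<le> (card A1 + card B1) * ?M + (card A2 + card B2) * ?M + (card A1 + card B2) * ?L"
      using P1(2) P2(2) P3(2) by linarith
    also have "\<dots> = (card A + card B) * ?M + (card A1 + card B2) * ?L"
      by (simp add: cA cB algebra_simps)
    also have "\<dots> \<le> (card A + card B) * ((m + 1) * ?L) + (card A + card B) * ?L"
    proof (intro add_mono mult_le_mono2 mult_le_mono1)
      show "?M \<le> (m + 1) * ?L"
        using mult_le_mono2[OF power_mono[of "m + 1" "m + 2" "length Rs"], of "m + 1"] by simp
    qed (simp_all add: cA cB)
    also have "\<dots> = (card A + card B) * (Suc m + 1) ^ length (R # Rs)"
      by (simp add: algebra_simps)
    finally show ?case using cover by blast
  qed
qed

section \<open>From rectangles to bicliques\<close>

text \<open>A rectangle of arcs has disjoint sides because there are no loops, so adding the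
  reversed arcs gives a biclique. This is why one orientation of each edge suffices.\<close>

lemma biclique_cover_of_rects:
  assumes G: "pair_graph G" and P: "rect_cover P S" and S: "S \<subseteq> parcs G"
    and all: "\<And>u v. (u, v) \<in> parcs G \<Longrightarrow> (u, v) \<in> S \<or> (v, u) \<in> S"
  shows "\<exists>\<H>. biclique_cover G \<H> \<and> cover_size \<H> \<le> rect_size P"
proof -
  interpret pair_graph G by (rule G)
  define h :: "'a set \<times> 'a set \<Rightarrow> 'a pair_pre_digraph"
    where "h = (\<lambda>(A, B). \<lparr>pverts = A \<union> B, parcs = A \<times> B \<union> B \<times> A\<rparr>)"
  \<comment> \<open>A biclique needs two nonempty sides; the discarded rectangles contain no
    pairs.\<close>
  define Q where "Q = {(A, B) \<in> P. A \<noteq> {} \<and> B \<noteq> {}}"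
  have fin: "finite P" and UN: "(\<Union>(A, B)\<in>P. A \<times> B) = S" using P by (auto simp: rect_cover_def)
  have "Q \<subseteq> P" by (auto simp: Q_def)
  then have finQ: "finite Q" using fin finite_subset by blast
  have arcs_sym: "(v, u) \<in> parcs G" if "(u, v) \<in> parcs G" for u v
    using that pair_sym_arcs by (auto simp: symmetric_def elim: symE)
  have good: "subgraph (with_proj (h (A, B))) (with_proj G) \<and> biclique (h (A, B))"
    if AB: "(A, B) \<in> Q" for A B
  proof -
    have ne: "A \<noteq> {}" "B \<noteq> {}" and arcs: "A \<times> B \<subseteq> parcs G"
      using AB UN S by (auto simp: Q_def)
    have disj: "A \<inter> B = {}" using arcs pair_no_loops by fastforce
    have V: "A \<subseteq> pverts G" "B \<subseteq> pverts G" using arcs ne in_arcsD1 in_arcsD2 by blast+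
    have finAB: "finite A" "finite B" using V pair_finite_verts finite_subset by blast+
    have "complete_bipartite_digraph (card A) (card B) (with_proj (h (A, B)))"
      using finAB disj by (auto simp: complete_bipartite_digraph_pair_def h_def)
    moreover have "1 \<le> card A" "1 \<le> card B" using ne finAB by (simp_all add: Suc_le_eq card_gt_0_iff)
    ultimately have "biclique (h (A, B))" unfolding biclique_def by blast
    moreover have "wf_digraph (with_proj (h (A, B)))"
      by unfold_locales (auto simp: h_def)
    moreover have "wf_digraph (with_proj G)" by unfold_locales
    ultimately show ?thesis using V arcs arcs_sym
      by (auto simp: subgraph_def compatible_def h_def)
  qed
  have "\<exists>H\<in>h ` Q. e \<in> parcs H" if "e \<in> parcs G" for e
  proof -
    obtain u v where e: "e = (u, v)" by (cases e)
    then have "(u, v) \<in> S \<or> (v, u) \<in> S" using all that by blast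
    then obtain A B where AB: "(A, B) \<in> P" "(u, v) \<in> A \<times> B \<or> (v, u) \<in> A \<times> B"
      unfolding UN[symmetric] by blast
    then have "(A, B) \<in> Q" "e \<in> parcs (h (A, B))" by (auto simp: Q_def h_def e)
    then show ?thesis by blast
  qed
  then have "biclique_cover G (h ` Q)"
    using finQ good by (auto simp: biclique_cover_def)
  \<comment> \<open>Only an inequality, since \<open>h\<close> identifies \<open>(A, B)\<close> with
    \<open>(B, A)\<close>.\<close>
  moreover have "cover_size (h ` Q) \<le> (\<Sum>AB\<in>Q. card (pverts (h AB)))"
    unfolding cover_size_def by (rule order.trans[OF sum_image_le]) (use finQ in auto)
  moreover have "\<dots> \<le> (\<Sum>(A, B)\<in>Q. card A + card B)"
    by (intro sum_mono) (auto simp: h_def card_Un_le)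
  moreover have "\<dots> \<le> rect_size P"
    unfolding rect_size_def by (intro sum_mono2 fin \<open>Q \<subseteq> P\<close>) auto
  ultimately show ?thesis by (meson order.trans)
qed

section \<open>Semilinear graphs as unions of threshold patterns\<close>

lemma linear_poly2_separated:
  assumes "linear_poly2 d f"
  shows "\<exists>\<alpha> \<beta>. \<forall>x y. f x y = \<alpha> x + \<beta> y"
proof -
  obtain a b c where "\<And>x y. f x y = (\<Sum>j<d. a j * x j) + (\<Sum>j<d. b j * y j) + c"
    using assms unfolding linear_poly2_def by blast
  then show ?thesis
    by (intro exI[of _ "\<lambda>x. \<Sum>j<d. a j * x j"] exI[of _ "\<lambda>y. (\<Sum>j<d. b j * y j) + c"]) simp
qed

text \<open>There are at most \<open>2 ^ (2 * t)\<close> truth patterns, each described by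
  \<open>2 * t + 1\<close> thresholds on two copies of the vertex set. The extra threshold
  \<open>num u < num v\<close> excludes the diagonal, about which \<open>\<Phi>\<close> says
  nothing.\<close>

lemma semilinear_rect_cover:
  assumes sl: "semilinear_graph t G" and m: "2 * card (pverts G) \<le> 2 ^ m"
  shows "\<exists>P S. rect_cover P S \<and> S \<subseteq> parcs G \<and>
           (\<forall>u v. (u, v) \<in> parcs G \<longrightarrow> (u, v) \<in> S \<or> (v, u) \<in> S) \<and>
           rect_size P \<le> 2 ^ (2 * t) * (2 * card (pverts G) * (m + 1) ^ (2 * t + 1))"
proof -
  interpret pair_graph G using sl by (simp add: semilinear_graph_def)
  define V where "V = pverts G"
  have finV: "finite V" unfolding V_def by (rule pair_finite_verts)
  from sl obtain d and \<phi> :: "'a \<Rightarrow> nat \<Rightarrow> real" and f \<Phi>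
    where lin: "\<forall>i<t. linear_poly2 d (f i)"
      and edge: "\<And>u v. u \<in> V \<Longrightarrow> v \<in> V \<Longrightarrow> u \<noteq> v \<Longrightarrow>
        (u, v) \<in> parcs G \<longleftrightarrow>
            \<Phi> (concat (map (\<lambda>i. [f i (\<phi> u) (\<phi> v) < 0,
                                  f i (\<phi> u) (\<phi> v) = 0,
                                  f i (\<phi> u) (\<phi> v) \<le> 0]) [0..<t]))"
    unfolding semilinear_graph_def V_def by blast
  obtain num :: "'a \<Rightarrow> nat" where num: "inj_on num V"
    using finite_imp_inj_to_nat_seg[OF finV] by blast
  \<comment> \<open>Equalities need no atoms: \<open>= 0\<close> means \<open>\<le> 0\<close> but
    not \<open>< 0\<close>.\<close>
  define atom where "atom = (\<lambda>j u v. if j < t then f j (\<phi> u) (\<phi> v) < 0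
                                     else f (j - t) (\<phi> u) (\<phi> v) \<le> 0)"
  have thr: "threshold (\<lambda>u v. atom j u v \<longleftrightarrow> b)" if j: "j < 2 * t" for j b
  proof -
    let ?i = "if j < t then j else j - t"
    have "linear_poly2 d (f ?i)" using lin j by auto
    then obtain \<alpha> \<beta> where sep: "\<And>x y. f ?i x y = \<alpha> x + \<beta> y"
      using linear_poly2_separated by blast
    show ?thesis
      using threshold_less[of "\<lambda>u. \<alpha> (\<phi> u)" "\<lambda>v. \<beta> (\<phi> v)" b]
        threshold_le[of "\<lambda>u. \<alpha> (\<phi> u)" "\<lambda>v. \<beta> (\<phi> v)" b] sep
      by (cases "j < t") (simp_all add: atom_def)
  qed
  have edge_eq: "(u, v) \<in> parcs G \<longleftrightarrow> (u', v') \<in> parcs G"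
    if "u \<in> V" "v \<in> V" "u \<noteq> v" "u' \<in> V" "v' \<in> V" "u' \<noteq> v'"
      and same: "\<And>j. j < 2 * t \<Longrightarrow> atom j u v \<longleftrightarrow> atom j u' v'" for u v u' v'
  proof -
    have "(f i (\<phi> u) (\<phi> v) < 0 \<longleftrightarrow> f i (\<phi> u') (\<phi> v') < 0) \<and>
      (f i (\<phi> u) (\<phi> v) \<le> 0 \<longleftrightarrow> f i (\<phi> u') (\<phi> v') \<le> 0)" if "i < t" for i
      using same[of i] same[of "t + i"] that by (simp add: atom_def)
    then have "(f i (\<phi> u) (\<phi> v) < 0 \<longleftrightarrow> f i (\<phi> u') (\<phi> v') < 0) \<and>
      (f i (\<phi> u) (\<phi> v) = 0 \<longleftrightarrow> f i (\<phi> u') (\<phi> v') = 0) \<and>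
      (f i (\<phi> u) (\<phi> v) \<le> 0 \<longleftrightarrow> f i (\<phi> u') (\<phi> v') \<le> 0)" if "i < t" for i
      using that by (metis order.order_iff_strict order.irrefl)
    then have "map (\<lambda>i. [f i (\<phi> u) (\<phi> v) < 0, f i (\<phi> u) (\<phi> v) = 0, f i (\<phi> u) (\<phi> v) \<le> 0]) [0..<t] =
      map (\<lambda>i. [f i (\<phi> u') (\<phi> v') < 0, f i (\<phi> u') (\<phi> v') = 0, f i (\<phi> u') (\<phi> v') \<le> 0]) [0..<t]"
      by (intro map_cong refl) simp
    then show ?thesis using edge that(1-6) by presburger
  qed
  define pat where "pat = (\<lambda>u v. {j. j < 2 * t \<and> atom j u v})"
  \<comment> \<open>Patterns realised by some arc; by \<open>edge_eq\<close>, any two distinct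
    vertices with such a pattern are adjacent.\<close>
  define I where "I = (\<lambda>(u, v). pat u v) ` parcs G"
  define S where "S = (\<lambda>T. {(u, v) \<in> V \<times> V. num u < num v \<and> pat u v = T})"
  have sub: "I \<subseteq> Pow {..<2 * t}" by (auto simp: I_def pat_def)
  then have finI: "finite I" by (rule finite_subset) simp
  have cardI: "card I \<le> 2 ^ (2 * t)" using card_mono[OF _ sub] by (simp add: card_Pow)
  have "\<exists>P. rect_cover P (S T) \<and> rect_size P \<le> 2 * card V * (m + 1) ^ (2 * t + 1)"
    if T: "T \<in> I" for T
  proof -
    let ?Rs = "(\<lambda>u v. num u < num v) # map (\<lambda>j u v. atom j u v \<longleftrightarrow> j \<in> T) [0..<2 * t]"
    have "threshold (\<lambda>u v. num u < num v)"
      unfolding threshold_def by (rule exI[of _ "\<lambda>u. real (num u)"]) auto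
    then have "\<forall>R\<in>set ?Rs. threshold R" using thr by auto
    then have *: "\<exists>P. rect_cover P {(u, v) \<in> V \<times> V. \<forall>R\<in>set ?Rs. R u v} \<and>
        rect_size P \<le> (card V + card V) * (m + 1) ^ length ?Rs"
      using rect_cover_thresholds[OF finV finV, of m ?Rs] m by (simp add: V_def)
    have "T \<subseteq> {..<2 * t}" using T sub by blast
    then have "pat u v = T \<longleftrightarrow> (\<forall>j<2 * t. atom j u v \<longleftrightarrow> j \<in> T)" for u v
      by (auto simp: pat_def)
    then have "{(u, v) \<in> V \<times> V. \<forall>R\<in>set ?Rs. R u v} = S T"
      by (auto simp: S_def)
    then show ?thesis using * by (simp add: mult_2)
  qed
  then obtain P where P: "rect_cover P (\<Union>T\<in>I. S T)"
    "rect_size P \<le> card I * (2 * card V * (m + 1) ^ (2 * t + 1))"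
    using rect_cover_UN[OF finI] by blast
  have "(\<Union>T\<in>I. S T) \<subseteq> parcs G"
  proof clarify
    fix T u v assume "T \<in> I" "(u, v) \<in> S T"
    then obtain u' v' where e: "(u', v') \<in> parcs G" "pat u' v' = pat u v"
      and uv: "u \<in> V" "v \<in> V" "u \<noteq> v"
      by (auto simp: I_def S_def)
    have "u' \<in> V" "v' \<in> V" "u' \<noteq> v'"
      using in_arcsD1[OF e(1)] in_arcsD2[OF e(1)] pair_no_loops[OF e(1)] by (simp_all add: V_def)
    moreover have "atom j u' v' \<longleftrightarrow> atom j u v" if "j < 2 * t" for j
      using e(2) that unfolding pat_def by blast
    ultimately show "(u, v) \<in> parcs G" using edge_eq e(1) uv by blast
  qed
  moreover have "(u, v) \<in> (\<Union>T\<in>I. S T) \<or> (v, u) \<in> (\<Union>T\<in>I. S T)" if uv: "(u, v) \<in> parcs G" for u v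
  proof -
    have vu: "(v, u) \<in> parcs G"
      using uv pair_sym_arcs by (auto simp: symmetric_def elim: symE)
    have V: "u \<in> V" "v \<in> V" "u \<noteq> v"
      using in_arcsD1[OF uv] in_arcsD2[OF uv] pair_no_loops[OF uv] by (simp_all add: V_def)
    then have "num u < num v \<or> num v < num u"
      using num by (metis inj_onD linorder_neqE_nat)
    then show ?thesis using uv vu V by (auto simp: I_def S_def)
  qed
  moreover have "rect_size P \<le> 2 ^ (2 * t) * (2 * card V * (m + 1) ^ (2 * t + 1))"
    using P(2) mult_le_mono1[OF cardI] order.trans by blast
  ultimately show ?thesis using P(1) unfolding V_def by blast
qed

section \<open>Logarithmic form of the bound\<close>

text \<open>Rounding up and doubling cost at most an additive 3 over \<open>log 2 n\<close>,
  absorbed into the factor 4 because \<open>log 2 n \<ge> 1\<close>.\<close>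

lemma log_scale:
  assumes "n \<ge> (2::nat)"
  obtains m where "2 * n \<le> 2 ^ m" "real (m + 1) \<le> 4 / ln 2 * ln (real n)"
proof
  let ?m = "nat \<lceil>log 2 (real n)\<rceil> + 1"
  have log1: "log 2 (real n) \<ge> 1" using assms by simp
  have "real n = 2 powr log 2 (real n)" using assms by simp
  also have "\<dots> \<le> 2 powr real (nat \<lceil>log 2 (real n)\<rceil>)"
    by (intro powr_mono) (auto intro: real_nat_ceiling_ge)
  also have "\<dots> = real (2 ^ nat \<lceil>log 2 (real n)\<rceil>)" by (simp add: powr_realpow)
  finally show "2 * n \<le> 2 ^ ?m" by (simp only: of_nat_le_iff) simp
  have "real (?m + 1) \<le> log 2 (real n) + 3" using log1 by linarith
  also have "\<dots> \<le> 4 * log 2 (real n)" using log1 by simp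
  finally show "real (?m + 1) \<le> 4 / ln 2 * ln (real n)" by (simp add: log_def)
qed

theorem theorem8:
  fixes t :: nat
  shows "\<exists>C>0. \<exists>c>0. \<forall>G :: 'a pair_pre_digraph.
           semilinear_graph t G \<and> card (pverts G) \<ge> 2 \<longrightarrow>
           (\<exists>\<H>. biclique_cover G \<H> \<and>
                real (cover_size \<H>) \<le>
                  C * real (card (pverts G)) * ln (real (card (pverts G))) powr c)"
proof -
  let ?k = "2 * t + 1"
  \<comment> \<open>\<open>2 ^ ?k\<close> combines the \<open>2 ^ (2 * t)\<close> patterns with the
    factor 2 for using the vertex set on both sides; the other factor comes from
    \<open>log_scale\<close>.\<close>
  let ?C = "2 ^ ?k * (4 / ln 2) ^ ?k :: real"
  show ?thesis
  proof (rule exI[of _ ?C], rule conjI[rotated], rule exI[of _ "real ?k"], intro conjI allI impI)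
    show "?C > 0" "real ?k > 0" by simp_all
    fix G :: "'a pair_pre_digraph"
    let ?n = "card (pverts G)"
    assume "semilinear_graph t G \<and> ?n \<ge> 2"
    then have sl: "semilinear_graph t G" and n: "?n \<ge> 2" by auto
    obtain m where m: "2 * ?n \<le> 2 ^ m" "real (m + 1) \<le> 4 / ln 2 * ln (real ?n)"
      using log_scale[OF n] .
    obtain P S where P: "rect_cover P S" "S \<subseteq> parcs G"
      "\<forall>u v. (u, v) \<in> parcs G \<longrightarrow> (u, v) \<in> S \<or> (v, u) \<in> S"
      and size: "rect_size P \<le> 2 ^ (2 * t) * (2 * ?n * (m + 1) ^ ?k)"
      using semilinear_rect_cover[OF sl m(1)] by blast
    obtain \<H> where \<H>: "biclique_cover G \<H>" "cover_size \<H> \<le> rect_size P"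
      using biclique_cover_of_rects[OF _ P(1,2)] P(3) sl unfolding semilinear_graph_def by blast
    have "real (cover_size \<H>) \<le> real (2 ^ (2 * t) * (2 * ?n * (m + 1) ^ ?k))"
      using \<H>(2) size by (intro of_nat_mono) linarith
    also have "\<dots> = 2 ^ ?k * real ?n * real (m + 1) ^ ?k" by (simp add: algebra_simps)
    also have "\<dots> \<le> 2 ^ ?k * real ?n * (4 / ln 2 * ln (real ?n)) ^ ?k"
      using m(2) by (intro mult_left_mono power_mono) auto
    also have "\<dots> = ?C * real ?n * ln (real ?n) ^ ?k"
      by (simp only: power_mult_distrib mult_ac)
    also have "\<dots> = ?C * real ?n * ln (real ?n) powr real ?k"
      using n by (subst powr_realpow) auto
    finally show "\<exists>\<H>. biclique_cover G \<H> \<and>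
        real (cover_size \<H>) \<le> ?C * real ?n * ln (real ?n) powr real ?k"
      using \<H>(1) by blast
  qed
qed

end
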